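(* Let $X$ be an Erdős space factor which is first category. Then $X$ contains a neighborhood (a subset of $X$ with non-empty interior in $X$) which is covered by countably many sets, each of which is a nowhere dense C-set in $X$.
   Context: All spaces are non-empty, separable and metrizable. A subset $A$ of a space $X$ is a C-set in $X$ if $A$ is an intersection of clopen subsets of $X$. The Erdős space is $\mathfrak E=\{x\in\ell^2: x_n\in\mathbb Q\text{ for all }n<\omega\}$ with the norm topology of $\ell^2$. A space $X$ is an Erdős space factor if there is a space $Y$ such that $X\times Y$ is homeomorphic to $\mathfrak E$. A space is first category if it is a countable union of nowhere dense subsets of itself. *)

theory Defs
  imports "HOL-Analysis.Analysis"
begin

definition ell2 :: "(nat \<Rightarrow> real) set" where
  "ell2 = {x. summable (\<lambda>n. (x n)\<^sup>2)}"

definition ell2_norm :: "(nat \<Rightarrow> real) \<Rightarrow> real" where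
  "ell2_norm x = sqrt (\<Sum>n. (x n)\<^sup>2)"

text \<open>The metric is cut off to 0 outside \<open>ell2\<close>, where the series may diverge; this is only
  because \<open>Metric_space\<close> requires nonnegativity on the whole type.\<close>

definition ell2_dist :: "(nat \<Rightarrow> real) \<Rightarrow> (nat \<Rightarrow> real) \<Rightarrow> real" where
  "ell2_dist x y =
    (if x \<in> ell2 \<and> y \<in> ell2 then ell2_norm (\<lambda>n. x n - y n) else 0)"

lemma ell2_L2_set_le:
  assumes "x \<in> ell2" shows "L2_set x {..<n} \<le> ell2_norm x"
  using assms unfolding ell2_def ell2_norm_def L2_set_def
  by (auto intro!: sum_le_suminf)

lemma ell2_add:
  assumes "x \<in> ell2" "y \<in> ell2"
  shows "(\<lambda>n. x n + y n) \<in> ell2"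
    and "ell2_norm (\<lambda>n. x n + y n) \<le> ell2_norm x + ell2_norm y"
proof -
  have b: "L2_set (\<lambda>n. x n + y n) {..<n} \<le> ell2_norm x + ell2_norm y" for n
    using L2_set_triangle_ineq[of x y "{..<n}"] ell2_L2_set_le[OF assms(1), of n]
      ell2_L2_set_le[OF assms(2), of n] by linarith
  have nn: "0 \<le> ell2_norm x + ell2_norm y"
    using b[of 0] by simp
  have b2: "(\<Sum>i<n. (x i + y i)\<^sup>2) \<le> (ell2_norm x + ell2_norm y)\<^sup>2" for n
    using b[of n] by (auto simp: L2_set_def intro: sqrt_le_D)
  show s: "(\<lambda>n. x n + y n) \<in> ell2"
    unfolding ell2_def using b2 by (auto intro!: summableI_nonneg_bounded)
  have "(\<Sum>i. (x i + y i)\<^sup>2) \<le> (ell2_norm x + ell2_norm y)\<^sup>2"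
    using s b2 by (intro suminf_le_const) (auto simp: ell2_def)
  then show "ell2_norm (\<lambda>n. x n + y n) \<le> ell2_norm x + ell2_norm y"
    unfolding ell2_norm_def[of "\<lambda>n. x n + y n"] using nn real_le_lsqrt by blast
qed

lemma ell2_diff:
  assumes "x \<in> ell2" "y \<in> ell2"
  shows "(\<lambda>n. x n - y n) \<in> ell2"
  using ell2_add(1)[of x "\<lambda>n. - y n"] assms by (simp add: ell2_def)

lemma Metric_space_ell2: "Metric_space ell2 ell2_dist"
proof
  show "ell2_dist x y = ell2_dist y x" for x y
    by (simp add: ell2_dist_def ell2_norm_def power2_commute)
  show "0 \<le> ell2_dist x y" for x y
    using ell2_diff[of x y] by (simp add: ell2_dist_def ell2_norm_def ell2_def suminf_nonneg)
  show "ell2_dist x y = 0 \<longleftrightarrow> x = y" if "x \<in> ell2" "y \<in> ell2" for x y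
    using that ell2_diff[OF that]
    by (simp add: ell2_dist_def ell2_norm_def ell2_def suminf_eq_zero_iff fun_eq_iff)
  show "ell2_dist x z \<le> ell2_dist x y + ell2_dist y z"
    if "x \<in> ell2" "y \<in> ell2" "z \<in> ell2" for x y z
    using ell2_add(2)[OF ell2_diff[OF that(1,2)] ell2_diff[OF that(2,3)]] that
    by (simp add: ell2_dist_def)
qed

definition ell2_topology :: "(nat \<Rightarrow> real) topology" where
  "ell2_topology = Metric_space.mtopology ell2 ell2_dist"

definition erdos_space :: "(nat \<Rightarrow> real) topology" where
  "erdos_space = subtopology ell2_topology {x. \<forall>n. x n \<in> \<rat>}"

lemma topspace_erdos_space:
  "topspace erdos_space = {x \<in> ell2. \<forall>n. x n \<in> \<rat>}"
  by (auto simp: erdos_space_def ell2_topology_def Metric_space.topspace_mtopology[OF Metric_space_ell2])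

definition sep_metrizable_space :: "'a topology \<Rightarrow> bool" where
  "sep_metrizable_space X \<longleftrightarrow>
     topspace X \<noteq> {} \<and> separable_space X \<and> metrizable_space X"

text \<open>HOL cannot quantify existentially over types, so the point type of the complementary factor
  is a parameter: \<open>erdos_space_factor TYPE('b) X\<close> asks for a complementary factor with points
  in \<open>'b\<close>. A theorem assuming it for an arbitrary \<open>'b\<close> covers every complementary factor.\<close>

definition erdos_space_factor :: "'b itself \<Rightarrow> 'a topology \<Rightarrow> bool" where
  "erdos_space_factor T X \<longleftrightarrow>
     (\<exists>Y :: 'b topology. sep_metrizable_space Y \<and> prod_topology X Y homeomorphic_space erdos_space)"

definition C_set_in :: "'a topology \<Rightarrow> 'a set \<Rightarrow> bool" where
  "C_set_in X A \<longleftrightarrow>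
     (\<exists>\<U>. \<U> \<noteq> {} \<and> (\<forall>U\<in>\<U>. closedin X U \<and> openin X U) \<and> A = \<Inter>\<U>)"

definition nowhere_dense_in :: "'a topology \<Rightarrow> 'a set \<Rightarrow> bool" where
  "nowhere_dense_in X A \<longleftrightarrow>
     A \<subseteq> topspace X \<and> X interior_of (X closure_of A) = {}"

definition first_category_space :: "'a topology \<Rightarrow> bool" where
  "first_category_space X \<longleftrightarrow>
     (\<exists>\<A>. countable \<A> \<and> (\<forall>A\<in>\<A>. nowhere_dense_in X A) \<and> topspace X = \<Union>\<A>)"

end

theory Submission
  imports Defs
begin

text \<open>Embed \<open>X\<close> as a closed subset of the Erdos space by \<open>e\<close>. Closed balls and sets with a
  prescribed finite prefix of coordinates pull back to C-sets, because each of them is an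
  intersection of sets \<open>{f \<le> a}\<close> with \<open>f\<close> continuous and rational-valued. Suppose that no
  neighborhood is covered by countably many nowhere dense C-sets, and let \<open>X = \<Union>n. A n\<close> with \<open>A n\<close>
  nowhere dense. Cutting a ball into its countably many prefix pieces, one of them is
  somewhere dense and contains a smaller ball missing \<open>A n\<close>; this gives a decreasing sequence of
  balls on which more and more coordinates are constant. The prefixes converge to a point \<open>q\<close>,
  which lies in \<open>ell2\<close> and in all the balls because these only bound partial sums. Choosing the
  prefixes long enough to leave the \<open>n\<close>-th of countably many balls that cover the complement of
  \<open>e ` X\<close> forces \<open>q = e z\<close>, and then \<open>z\<close> lies in no \<open>A n\<close>.\<close>

section \<open>C-sets: intersections and sublevel sets\<close>

lemma C_set_in_Inter:
  assumes "I \<noteq> {}" "\<And>i. i \<in> I \<Longrightarrow> C_set_in X (A i)"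
  shows "C_set_in X (\<Inter>i\<in>I. A i)"
proof -
  obtain \<U> where \<U>: "\<And>i. i \<in> I \<Longrightarrow>
      \<U> i \<noteq> {} \<and> (\<forall>U\<in>\<U> i. closedin X U \<and> openin X U) \<and> A i = \<Inter>(\<U> i)"
    using assms(2) unfolding C_set_in_def by metis
  have "(\<Inter>i\<in>I. A i) = \<Inter>(\<Union>i\<in>I. \<U> i)"
    using \<U> by auto
  then show ?thesis
    unfolding C_set_in_def using assms(1) \<U> by (intro exI[of _ "\<Union>i\<in>I. \<U> i"]) auto
qed

lemma C_set_in_Int:
  assumes "C_set_in X A" "C_set_in X B"
  shows "C_set_in X (A \<inter> B)"
proof -
  have "C_set_in X (\<Inter>S\<in>{A, B}. S)"
    using assms by (intro C_set_in_Inter) auto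
  then show ?thesis by simp
qed

lemma C_set_in_imp_closedin: "C_set_in X A \<Longrightarrow> closedin X A"
  unfolding C_set_in_def by (metis closedin_Inter)

lemma irrational_between:
  assumes "(a::real) < b"
  obtains s where "a < s" "s < b" "s \<notin> \<rat>"
proof -
  have "uncountable {a<..<b}"
    using assms by (simp add: uncountable_open_interval)
  then have "\<not> {a<..<b} \<subseteq> \<rat>"
    using countable_rat countable_subset by blast
  then obtain s where "s \<in> {a<..<b}" "s \<notin> \<rat>"
    by blast
  then show ?thesis
    using that[of s] by simp
qed

text \<open>At an irrational level \<open>s\<close> the sets \<open>{f < s}\<close> and \<open>{f \<le> s}\<close> coincide and are clopen.\<close>

lemma C_set_in_sublevel:
  assumes f: "continuous_map X euclideanreal f"
    and rat: "\<And>x. x \<in> topspace X \<Longrightarrow> f x \<in> \<rat>"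
  shows "C_set_in X {x \<in> topspace X. f x \<le> a}"
proof -
  define \<U> where "\<U> = (\<lambda>s. {x \<in> topspace X. f x < s}) ` {s. a < s \<and> s \<notin> \<rat>}"
  have "\<U> \<noteq> {}"
    using irrational_between[of a "a + 1"] unfolding \<U>_def
    by (metis (mono_tags, lifting) empty_iff image_is_empty less_add_one mem_Collect_eq)
  moreover have "closedin X {x \<in> topspace X. f x < s}" if "s \<notin> \<rat>" for s
  proof -
    have "{x \<in> topspace X. f x < s} = {x \<in> topspace X. f x \<in> {..s}}"
      using rat that by (auto simp: less_le)
    then show ?thesis
      using closedin_continuous_map_preimage[OF f, of "{..s}"] by simp
  qed
  moreover have "openin X {x \<in> topspace X. f x < s}" for s
    using openin_continuous_map_preimage[OF f, of "{..<s}"] by simp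
  \<comment> \<open>Irrational levels are dense, so some level strictly between \<open>a\<close> and
    \<open>f x\<close> excludes any \<open>x\<close> with \<open>f x > a\<close>.\<close>
  moreover have "{x \<in> topspace X. f x \<le> a} = \<Inter>\<U>"
  proof
    show "{x \<in> topspace X. f x \<le> a} \<subseteq> \<Inter>\<U>"
      unfolding \<U>_def by auto
    show "\<Inter>\<U> \<subseteq> {x \<in> topspace X. f x \<le> a}"
    proof
      fix x assume x: "x \<in> \<Inter>\<U>"
      then have "x \<in> topspace X"
        using \<open>\<U> \<noteq> {}\<close> unfolding \<U>_def by auto
      moreover have "f x \<le> a"
      proof (rule ccontr)
        assume "\<not> f x \<le> a"
        then obtain s where "a < s" "s < f x" "s \<notin> \<rat>"
          using irrational_between[of a "f x"] by auto
        then show False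
          using x unfolding \<U>_def by force
      qed
      ultimately show "x \<in> {x \<in> topspace X. f x \<le> a}" by simp
    qed
  qed
  ultimately show ?thesis
    unfolding C_set_in_def by (intro exI[of _ \<U>]) (auto simp: \<U>_def)
qed

section \<open>Distances through partial sums, and the topology of the Erdos space\<close>

lemma mem_ell2I:
  assumes "c \<in> ell2" "\<And>m. (\<Sum>i<m. (q i - c i)\<^sup>2) \<le> b"
  shows "q \<in> ell2"
proof -
  have "(\<lambda>n. q n - c n) \<in> ell2"
    unfolding ell2_def using assms(2) by (auto intro!: summableI_nonneg_bounded)
  from ell2_add(1)[OF this assms(1)] show ?thesis by simp
qed

text \<open>Partial sums of squares increase to the full sum. This splits a closed ball into
  conditions on finitely many coordinates each, which can be checked for a sequence known only
  coordinatewise.\<close>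

lemma ell2_dist_le_iff:
  assumes "x \<in> ell2" "y \<in> ell2" "0 \<le> r"
  shows "ell2_dist x y \<le> r \<longleftrightarrow> (\<forall>m. (\<Sum>i<m. (x i - y i)\<^sup>2) \<le> r\<^sup>2)"
proof -
  have s: "summable (\<lambda>i. (x i - y i)\<^sup>2)"
    using ell2_diff[OF assms(1,2)] by (simp add: ell2_def)
  have "ell2_dist x y \<le> r \<longleftrightarrow> (\<Sum>i. (x i - y i)\<^sup>2) \<le> r\<^sup>2"
    using assms real_sqrt_le_iff[of _ "r\<^sup>2"] by (simp add: ell2_dist_def ell2_norm_def)
  also have "\<dots> \<longleftrightarrow> (\<forall>m. (\<Sum>i<m. (x i - y i)\<^sup>2) \<le> r\<^sup>2)"
    using s by (meson order_trans sum_le_suminf suminf_le_const zero_le_power2 finite_lessThan)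
  finally show ?thesis .
qed

lemma ell2_coordinate_le_dist:
  assumes "x \<in> ell2" "y \<in> ell2"
  shows "\<bar>x i - y i\<bar> \<le> ell2_dist x y"
proof -
  have nn: "0 \<le> ell2_dist x y"
    using Metric_space.nonneg[OF Metric_space_ell2] .
  have "(x i - y i)\<^sup>2 \<le> (\<Sum>j<Suc i. (x j - y j)\<^sup>2)"
    by (simp add: sum_nonneg)
  also have "\<dots> \<le> (ell2_dist x y)\<^sup>2"
    using ell2_dist_le_iff[OF assms nn] by blast
  finally show ?thesis
    using nn by (metis abs_le_square_iff abs_of_nonneg)
qed

lemma openin_erdos_space_ball:
  assumes "q \<in> ell2"
  shows "openin erdos_space {z \<in> topspace erdos_space. ell2_dist q z < \<epsilon>}"
proof -
  have "{z \<in> topspace erdos_space. ell2_dist q z < \<epsilon>}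
      = Metric_space.mball ell2 ell2_dist q \<epsilon> \<inter> {x. \<forall>n. x n \<in> \<rat>}"
    using assms by (auto simp: topspace_erdos_space Metric_space.in_mball[OF Metric_space_ell2])
  then show ?thesis
    unfolding erdos_space_def ell2_topology_def openin_subtopology
    using Metric_space.openin_mball[OF Metric_space_ell2] by blast
qed

lemma openin_erdos_space_ball_subset:
  assumes "openin erdos_space W" "q \<in> W"
  obtains \<epsilon> where "\<epsilon> > 0" "{z \<in> topspace erdos_space. ell2_dist q z < \<epsilon>} \<subseteq> W"
proof -
  obtain T where T: "openin (Metric_space.mtopology ell2 ell2_dist) T" "W = T \<inter> {x. \<forall>n. x n \<in> \<rat>}"
    using assms(1) unfolding erdos_space_def ell2_topology_def openin_subtopology by blast
  then obtain \<epsilon> where "\<epsilon> > 0" and \<epsilon>: "Metric_space.mball ell2 ell2_dist q \<epsilon> \<subseteq> T"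
    using assms(2) unfolding Metric_space.openin_mtopology[OF Metric_space_ell2] by blast
  moreover have "q \<in> ell2"
    using assms T unfolding Metric_space.openin_mtopology[OF Metric_space_ell2] by blast
  ultimately have "{z \<in> topspace erdos_space. ell2_dist q z < \<epsilon>} \<subseteq> W"
    using T(2) by (auto simp: topspace_erdos_space Metric_space.in_mball[OF Metric_space_ell2])
  then show ?thesis using that \<open>\<epsilon> > 0\<close> by blast
qed

lemma continuous_map_erdos_space_coordinate:
  "continuous_map erdos_space euclideanreal (\<lambda>x. x i)"
  unfolding mtopology_is_euclidean[symmetric] Met_TC.continuous_map_to_metric
proof (intro ballI allI impI)
  fix x and \<epsilon> :: real assume x: "x \<in> topspace erdos_space" and "0 < \<epsilon>"
  have "x \<in> ell2" using x by (simp add: topspace_erdos_space)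
  moreover have "ell2_dist x x = 0"
    using \<open>x \<in> ell2\<close> Metric_space.mdist_zero[OF Metric_space_ell2] by blast
  ultimately show "\<exists>U. openin erdos_space U \<and> x \<in> U \<and> (\<forall>y\<in>U. y i \<in> Met_TC.mball (x i) \<epsilon>)"
    using x \<open>0 < \<epsilon>\<close> openin_erdos_space_ball[of x \<epsilon>] ell2_coordinate_le_dist[of x _ i]
    by (intro exI[of _ "{z \<in> topspace erdos_space. ell2_dist x z < \<epsilon>}"])
      (fastforce simp: topspace_erdos_space dist_real_def)
qed

section \<open>Erdos space factors as closed subspaces of the Erdos space\<close>

lemma erdos_space_factor_closed_embedding:
  assumes "erdos_space_factor TYPE('b) (X :: 'a topology)"
  obtains e where "continuous_map X erdos_space e" "closed_map X erdos_space e"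
    "inj_on e (topspace X)"
proof -
  obtain Y :: "'b topology" and h g where Y: "sep_metrizable_space Y"
    and hg: "homeomorphic_maps (prod_topology X Y) erdos_space h g"
    using assms unfolding erdos_space_factor_def homeomorphic_space_def by blast
  obtain b where b: "b \<in> topspace Y"
    using Y unfolding sep_metrizable_space_def by blast
  have h: "homeomorphic_map (prod_topology X Y) erdos_space h"
    using hg homeomorphic_maps_map by blast
  have c: "continuous_map X Y (\<lambda>x. b)"
    using b by simp
  \<comment> \<open>The slice of the product over \<open>b\<close> is the graph of a constant map,
    so it is closed because \<open>Y\<close> is Hausdorff.\<close>
  have "Hausdorff_space Y"
    using Y metrizable_imp_Hausdorff_space unfolding sep_metrizable_space_def by blast
  then have cl: "closed_map X (prod_topology X Y) (\<lambda>x. (x, b))"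
    using closed_map_paired_continuous_map_right[OF c] by blast
  have "continuous_map X (prod_topology X Y) (\<lambda>x. (x, b))"
    using c by (simp add: continuous_map_pairedI)
  then have "continuous_map X erdos_space (h \<circ> (\<lambda>x. (x, b)))"
    using h continuous_map_compose homeomorphic_imp_continuous_map by blast
  moreover have "closed_map X erdos_space (h \<circ> (\<lambda>x. (x, b)))"
    using h cl closed_map_compose homeomorphic_imp_closed_map by blast
  moreover have "inj_on (h \<circ> (\<lambda>x. (x, b))) (topspace X)"
    using homeomorphic_imp_injective_map[OF h] b by (auto simp: inj_on_def)
  ultimately show ?thesis using that by blast
qed

text \<open>Both factors are separable, and the product of countable dense sets is dense in the
  product; the homeomorphism transfers this.\<close>

lemma separable_space_erdos_space:
  assumes "sep_metrizable_space (X :: 'a topology)" "erdos_space_factor TYPE('b) X"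
  shows "separable_space erdos_space"
proof -
  obtain Y :: "'b topology" where Y: "sep_metrizable_space Y"
    and hom: "prod_topology X Y homeomorphic_space erdos_space"
    using assms(2) unfolding erdos_space_factor_def by blast
  obtain C D where "countable C" "C \<subseteq> topspace X" "X closure_of C = topspace X"
    "countable D" "D \<subseteq> topspace Y" "Y closure_of D = topspace Y"
    using assms(1) Y unfolding sep_metrizable_space_def separable_space_def by blast
  then have "separable_space (prod_topology X Y)"
    unfolding separable_space_def by (intro exI[of _ "C \<times> D"]) (auto simp: closure_of_Times)
  then show ?thesis
    using homeomorphic_separable_space[OF hom] by blast
qed

text \<open>The complement of \<open>F\<close> is covered by countably many closed balls missing \<open>F\<close>. Lying outside
  such a ball is witnessed by finitely many coordinates.\<close>

lemma closedin_erdos_space_finite_witnesses: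
  assumes "separable_space erdos_space" and F: "closedin erdos_space F"
  obtains r :: "nat \<Rightarrow> real" and c :: "nat \<Rightarrow> nat \<Rightarrow> real"
  where "\<forall>n. \<forall>x\<in>F. \<exists>m. r n < (\<Sum>i<m. (x i - c n i)\<^sup>2)"
    and "\<forall>q\<in>topspace erdos_space. (\<forall>n. \<exists>m. r n < (\<Sum>i<m. (q i - c n i)\<^sup>2)) \<longrightarrow> q \<in> F"
proof -
  obtain D where D: "countable D" "D \<subseteq> topspace erdos_space"
    "erdos_space closure_of D = topspace erdos_space"
    using assms(1) unfolding separable_space_def by blast
  \<comment> \<open>The inserted pair satisfies the witness condition with \<open>m = 0\<close>, as
    the empty sum exceeds -1. It makes \<open>I\<close> nonempty at once, as the enumeration by
    \<open>from_nat_into\<close> requires.\<close>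
  define I where "I = insert ((\<lambda>i. 0), -1)
    {(d, s). d \<in> D \<and> s \<in> \<rat> \<and> (\<forall>x\<in>F. \<exists>m. s < (\<Sum>i<m. (x i - d i)\<^sup>2))}"
  have "I \<subseteq> insert ((\<lambda>i. 0), -1) (D \<times> \<rat>)"
    unfolding I_def by auto
  then have I: "countable I" "I \<noteq> {}"
    using D(1) countable_rat by (auto simp: I_def dest: countable_subset)
  define c where "c n = fst (from_nat_into I n)" for n
  define r where "r n = snd (from_nat_into I n)" for n
  show ?thesis
  proof (rule that[of r c]; intro allI ballI impI)
    fix n x assume "x \<in> F"
    have "(c n, r n) \<in> I"
      unfolding c_def r_def using from_nat_into[OF I(2)] by simp
    then show "\<exists>m. r n < (\<Sum>i<m. (x i - c n i)\<^sup>2)"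
      using \<open>x \<in> F\<close> unfolding I_def by (auto intro: exI[of _ 0])
  next
    fix q assume q: "q \<in> topspace erdos_space" and out: "\<forall>n. \<exists>m. r n < (\<Sum>i<m. (q i - c n i)\<^sup>2)"
    show "q \<in> F"
    proof (rule ccontr)
      assume "q \<notin> F"
      then obtain \<epsilon> where "\<epsilon> > 0" and \<epsilon>: "{z \<in> topspace erdos_space. ell2_dist q z < \<epsilon>} \<subseteq> topspace erdos_space - F"
        using openin_erdos_space_ball_subset[of "topspace erdos_space - F" q] F q by blast
      have q2: "q \<in> ell2" using q by (simp add: topspace_erdos_space)
      have "ell2_dist q q = 0"
        using q2 Metric_space.mdist_zero[OF Metric_space_ell2] by blast
      define W where "W = {z \<in> topspace erdos_space. ell2_dist q z < \<epsilon>/4}"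
      have "q \<in> W" "openin erdos_space W"
        using q \<open>\<epsilon> > 0\<close> \<open>ell2_dist q q = 0\<close> openin_erdos_space_ball[OF q2, of "\<epsilon>/4"]
        by (auto simp: W_def)
      moreover have "q \<in> erdos_space closure_of D"
        using q D(3) by simp
      ultimately obtain d where "d \<in> D" "d \<in> W"
        by (meson in_closure_of)
      then have d: "d \<in> D" "ell2_dist q d < \<epsilon>/4"
        by (auto simp: W_def)
      then have d2: "d \<in> ell2" using D(2) by (auto simp: topspace_erdos_space)
      \<comment> \<open>The closed ball around \<open>d\<close> of squared radius \<open>s\<close>
        contains \<open>q\<close>, since \<open>s\<close> exceeds
        \<open>(\<epsilon>/4)\<^sup>2\<close>. Its points are within \<open>\<epsilon>/2\<close> of
        \<open>d\<close>, hence within \<open>3\<epsilon>/4\<close> of \<open>q\<close>, so it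
        misses \<open>F\<close>. Thus \<open>(d, s)\<close> is in \<open>I\<close>, and
        \<open>out\<close> at its index is contradicted.\<close>
      have "(\<epsilon>/4)\<^sup>2 < (\<epsilon>/2)\<^sup>2"
        using \<open>\<epsilon> > 0\<close> by (intro power_strict_mono) auto
      then obtain s where s: "s \<in> \<rat>" "(\<epsilon>/4)\<^sup>2 < s" "s < (\<epsilon>/2)\<^sup>2"
        using Rats_dense_in_real by blast
      have "\<exists>m. s < (\<Sum>i<m. (x i - d i)\<^sup>2)" if "x \<in> F" for x
      proof (rule ccontr)
        assume "\<not> (\<exists>m. s < (\<Sum>i<m. (x i - d i)\<^sup>2))"
        then have "(\<Sum>i<m. (x i - d i)\<^sup>2) \<le> (\<epsilon>/2)\<^sup>2" for m
          using s(3) by (meson less_le not_le order_trans)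
        moreover have x: "x \<in> topspace erdos_space"
          using that F closedin_subset by blast
        then have x2: "x \<in> ell2" by (simp add: topspace_erdos_space)
        ultimately have "ell2_dist x d \<le> \<epsilon>/2"
          using ell2_dist_le_iff[OF x2 d2, of "\<epsilon>/2"] \<open>\<epsilon> > 0\<close> by simp
        moreover have "ell2_dist q x \<le> ell2_dist q d + ell2_dist x d"
          using Metric_space.triangle'[OF Metric_space_ell2 q2 d2 x2] .
        ultimately show False
          using x \<epsilon> that d(2) \<open>\<epsilon> > 0\<close> by auto
      qed
      then have "(d, s) \<in> I"
        using d(1) s(1) unfolding I_def by blast
      then obtain n where "from_nat_into I n = (d, s)"
        using from_nat_into_surj[OF I(1)] by blast
      then obtain m where "s < (\<Sum>i<m. (q i - d i)\<^sup>2)"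
        using spec[OF out, of n] by (auto simp: c_def r_def)
      moreover have "(\<Sum>i<m. (q i - d i)\<^sup>2) \<le> (\<epsilon>/4)\<^sup>2"
        using d(2) \<open>\<epsilon> > 0\<close> ell2_dist_le_iff[OF q2 d2, of "\<epsilon>/4"] by simp
      ultimately show False
        using s(2) by linarith
    qed
  qed
qed

section \<open>From uncoverable neighborhoods to a point outside every \<open>A n\<close>\<close>

theorem theorem8:
  fixes X :: "'a topology"
  assumes "sep_metrizable_space X"
    and "erdos_space_factor TYPE('b) X"
    and "first_category_space X"
  shows "\<exists>N. N \<subseteq> topspace X \<and> X interior_of N \<noteq> {} \<and>
           (\<exists>\<A>. countable \<A> \<and> N \<subseteq> \<Union>\<A> \<and>
                 (\<forall>A\<in>\<A>. nowhere_dense_in X A \<and> C_set_in X A))"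
proof (rule ccontr)
  assume neg: "\<not> ?thesis"
  \<comment> \<open>A C-set is closed, so for it nowhere dense just means having empty
    interior.\<close>
  have not_covered: "\<exists>A\<in>\<A>. X interior_of A \<noteq> {}"
    if "N \<subseteq> topspace X" "X interior_of N \<noteq> {}" "countable \<A>" "N \<subseteq> \<Union>\<A>"
      "\<And>A. A \<in> \<A> \<Longrightarrow> C_set_in X A" for N \<A>
  proof (rule ccontr)
    assume "\<not> ?thesis"
    then have "nowhere_dense_in X A \<and> C_set_in X A" if "A \<in> \<A>" for A
      using \<open>\<And>A. A \<in> \<A> \<Longrightarrow> C_set_in X A\<close>[OF that] that C_set_in_imp_closedin[of X A]
      by (simp add: nowhere_dense_in_def closure_of_closedin closedin_subset)
    then show False
      using neg that(1-4) by blast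
  qed
  obtain e where e: "continuous_map X erdos_space e" "closed_map X erdos_space e"
    and inj: "inj_on e (topspace X)"
    using erdos_space_factor_closed_embedding[OF assms(2)] .
  have eE: "e x \<in> topspace erdos_space" if "x \<in> topspace X" for x
    using that e(1) continuous_map_image_subset_topspace by blast
  then have e2: "e x \<in> ell2" and eQ: "e x i \<in> \<rat>" if "x \<in> topspace X" for x i
    using that by (auto simp: topspace_erdos_space)
  have image: "closedin erdos_space (e ` topspace X)"
    using e(2) closed_map_def by blast
  obtain r :: "nat \<Rightarrow> real" and c :: "nat \<Rightarrow> nat \<Rightarrow> real"
    where wit: "\<forall>n. \<forall>y\<in>e ` topspace X. \<exists>m. r n < (\<Sum>i<m. (y i - c n i)\<^sup>2)"
      and in_image: "\<forall>q\<in>topspace erdos_space.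
        (\<forall>n. \<exists>m. r n < (\<Sum>i<m. (q i - c n i)\<^sup>2)) \<longrightarrow> q \<in> e ` topspace X"
    using closedin_erdos_space_finite_witnesses
      [OF separable_space_erdos_space[OF assms(1,2)] image] .
  obtain x0 where x0: "x0 \<in> topspace X"
    using assms(1) unfolding sep_metrizable_space_def by blast
  obtain A :: "nat \<Rightarrow> 'a set" where nd: "\<And>n. nowhere_dense_in X (A n)" and cover: "topspace X = (\<Union>n. A n)"
  proof -
    obtain \<A> where \<A>: "countable \<A>" "\<forall>A\<in>\<A>. nowhere_dense_in X A" "topspace X = \<Union>\<A>"
      using assms(3) unfolding first_category_space_def by (elim exE conjE) (rule that)
    have "\<A> \<noteq> {}" using x0 \<A>(3) by blast
    show ?thesis
    proof (rule that)
      show "nowhere_dense_in X (from_nat_into \<A> n)" for n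
        using \<A>(2) from_nat_into[OF \<open>\<A> \<noteq> {}\<close>] by blast
      show "topspace X = (\<Union>n. from_nat_into \<A> n)"
        using range_from_nat_into[OF \<open>\<A> \<noteq> {}\<close> \<A>(1)] \<A>(3) by simp
    qed
  qed
  \<comment> \<open>Common form of both kinds of sets: \<open>a = 0\<close> fixes a prefix, and
    intersecting over \<open>m\<close> gives a closed ball. The full sum of squares may be
    irrational, but its partial sums are rational when \<open>v\<close> is.\<close>
  define P where "P v m a = {x \<in> topspace X. (\<Sum>i<m. (e x i - v i)\<^sup>2) \<le> a}" for v m and a :: real
  have P: "C_set_in X (P v m a)" if "\<And>i. i < m \<Longrightarrow> v i \<in> \<rat>" for v m a
    unfolding P_def
  proof (rule C_set_in_sublevel)
    have "continuous_map X euclideanreal (\<lambda>x. e x i)" for i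
      using continuous_map_compose[OF e(1) continuous_map_erdos_space_coordinate[of i]]
      by (simp add: o_def)
    then show "continuous_map X euclideanreal (\<lambda>x. \<Sum>i<m. (e x i - v i)\<^sup>2)"
      by (intro continuous_intros) auto
    show "(\<Sum>i<m. (e x i - v i)\<^sup>2) \<in> \<rat>" if "x \<in> topspace X" for x
      using eQ[OF that] \<open>\<And>i. i < m \<Longrightarrow> v i \<in> \<rat>\<close> by (intro Rats_sum Rats_power Rats_diff) auto
  qed
  \<comment> \<open>Here \<open>\<rho>\<close> is the square of the radius.\<close>
  define B where "B x \<rho> = (\<Inter>m. P (e x) m \<rho>)" for x \<rho>
  have B_iff: "y \<in> B x \<rho> \<longleftrightarrow> y \<in> topspace X \<and> (\<forall>m. (\<Sum>i<m. (e y i - e x i)\<^sup>2) \<le> \<rho>)" for x y \<rho>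
    by (auto simp: B_def P_def)
  have B_C_set: "C_set_in X (B x \<rho>)" if "x \<in> topspace X" for x \<rho>
    unfolding B_def using eQ[OF that] by (intro C_set_in_Inter P) auto
  have B_interior: "X interior_of (B x \<rho>) \<noteq> {}" if "x \<in> topspace X" "\<rho> > 0" for x \<rho>
  proof -
    let ?W = "{y \<in> topspace X. e y \<in> {z \<in> topspace erdos_space. ell2_dist (e x) z < sqrt \<rho>}}"
    have "openin X ?W"
      using openin_continuous_map_preimage[OF e(1) openin_erdos_space_ball[OF e2[OF that(1)]]] .
    moreover have "x \<in> ?W"
      using that eE[OF that(1)] e2[OF that(1)] Metric_space.mdist_zero[OF Metric_space_ell2] by auto
    moreover have "?W \<subseteq> B x \<rho>"
    proof
      fix y assume y: "y \<in> ?W"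
      then have "ell2_dist (e y) (e x) \<le> sqrt \<rho>"
        using Metric_space.commute[OF Metric_space_ell2] by (metis (mono_tags, lifting) less_imp_le mem_Collect_eq)
      then show "y \<in> B x \<rho>"
        using y ell2_dist_le_iff[OF e2 e2, of y x "sqrt \<rho>"] that by (auto simp: B_iff)
    qed
    ultimately show ?thesis
      using interior_of_maximal by blast
  qed
  have B_subset: "\<exists>\<rho>>0. B x \<rho> \<subseteq> U" if U: "openin X U" "x \<in> U" for x U
  proof -
    have xX: "x \<in> topspace X" using U openin_subset by blast
    \<comment> \<open>Since \<open>e\<close> is closed and injective, \<open>e x\<close> has
      positive distance from the image of the complement of \<open>U\<close>. This is why the balls
      form a neighborhood base.\<close>
    have "closedin erdos_space (e ` (topspace X - U))"
      using e(2) U(1) unfolding closed_map_def by blast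
    moreover have "e x \<notin> e ` (topspace X - U)"
      using inj U(2) xX by (auto dest: inj_onD)
    ultimately obtain \<epsilon> where "\<epsilon> > 0"
      and \<epsilon>: "{z \<in> topspace erdos_space. ell2_dist (e x) z < \<epsilon>} \<subseteq> topspace erdos_space - e ` (topspace X - U)"
      using openin_erdos_space_ball_subset[of "topspace erdos_space - e ` (topspace X - U)" "e x"] eE[OF xX]
      by blast
    have "B x ((\<epsilon>/2)\<^sup>2) \<subseteq> U"
    proof
      fix y assume y: "y \<in> B x ((\<epsilon>/2)\<^sup>2)"
      then have yX: "y \<in> topspace X" by (simp add: B_iff)
      then have "ell2_dist (e y) (e x) \<le> \<epsilon>/2"
        using y ell2_dist_le_iff[OF e2[OF yX] e2[OF xX], of "\<epsilon>/2"] \<open>\<epsilon> > 0\<close> by (simp add: B_iff)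
      then have "ell2_dist (e x) (e y) < \<epsilon>"
        using Metric_space.commute[OF Metric_space_ell2, of "e x" "e y"] \<open>\<epsilon> > 0\<close> by simp
      then show "y \<in> U"
        using \<epsilon> yX eE[OF yX] by blast
    qed
    then show ?thesis
      using \<open>\<epsilon> > 0\<close> by (intro exI[of _ "(\<epsilon>/2)\<^sup>2"]) auto
  qed
  \<comment> \<open>The length bound makes every coordinate eventually fixed; the last condition
    places each extension of \<open>xs\<close> outside the \<open>n\<close>-th witness ball.\<close>
  define G where "G n = {xs :: real list. set xs \<subseteq> \<rat> \<and> n \<le> length xs \<and>
    r n < (\<Sum>i<length xs. (xs ! i - c n i)\<^sup>2)}" for n
  have "G n \<subseteq> lists \<rat>" for n
    unfolding G_def by auto
  then have G_countable: "countable (G n)" for n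
    by (rule countable_subset[OF _ countable_lists[OF countable_rat]])
  define T where "T xs = {x \<in> topspace X. \<forall>i<length xs. e x i = xs ! i}" for xs
  have T_P: "T xs = P (\<lambda>i. xs ! i) (length xs) 0" for xs
  proof -
    have "(\<Sum>i<length xs. (e x i - xs ! i)\<^sup>2) \<le> 0 \<longleftrightarrow> (\<forall>i<length xs. e x i = xs ! i)" for x
    proof -
      have "0 \<le> (\<Sum>i<length xs. (e x i - xs ! i)\<^sup>2)"
        by (rule sum_nonneg) simp
      then have "(\<Sum>i<length xs. (e x i - xs ! i)\<^sup>2) \<le> 0 \<longleftrightarrow> (\<Sum>i<length xs. (e x i - xs ! i)\<^sup>2) = 0"
        by linarith
      also have "\<dots> \<longleftrightarrow> (\<forall>i\<in>{..<length xs}. (e x i - xs ! i)\<^sup>2 = 0)"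
        by (rule sum_nonneg_eq_0_iff) auto
      finally show ?thesis by (simp add: Ball_def)
    qed
    then show ?thesis by (simp add: T_def P_def)
  qed
  have T_C_set: "C_set_in X (T xs)" if "xs \<in> G n" for xs n
    unfolding T_P using that by (intro P) (auto simp: G_def)
  have T_cover: "\<exists>xs\<in>G n. x \<in> T xs" if x: "x \<in> topspace X" for x n
  proof -
    obtain m where m: "r n < (\<Sum>i<m. (e x i - c n i)\<^sup>2)"
      using wit x by blast
    \<comment> \<open>Lengthening the prefix to reach length \<open>n\<close> only adds squares, so
      the witness survives.\<close>
    also have "\<dots> \<le> (\<Sum>i<max m n. (e x i - c n i)\<^sup>2)"
      by (intro sum_mono2) auto
    finally have "map (e x) [0..<max m n] \<in> G n"
      using eQ[OF x] by (auto simp: G_def)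
    moreover have "x \<in> T (map (e x) [0..<max m n])"
      using x by (simp add: T_def)
    ultimately show ?thesis by blast
  qed
  have step: "\<exists>y \<sigma> xs. y \<in> topspace X \<and> \<sigma> > 0 \<and> xs \<in> G n \<and> B y \<sigma> \<subseteq> B x \<rho> \<inter> T xs - A n"
    if x: "x \<in> topspace X" "\<rho> > 0" for x \<rho> n
  proof -
    have "C_set_in X (B x \<rho> \<inter> T xs)" if "xs \<in> G n" for xs
      using C_set_in_Int[OF B_C_set[OF x(1)] T_C_set[OF that]] .
    then have "\<exists>S\<in>(\<lambda>xs. B x \<rho> \<inter> T xs) ` G n. X interior_of S \<noteq> {}"
      using T_cover[of _ n] B_interior[OF x] G_countable[of n]
      by (intro not_covered[of "B x \<rho>"]) (auto simp: B_iff)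
    then obtain xs where xs: "xs \<in> G n" and int: "X interior_of (B x \<rho> \<inter> T xs) \<noteq> {}"
      by blast
    let ?U = "X interior_of (B x \<rho> \<inter> T xs)"
    have "\<not> ?U \<subseteq> X closure_of A n"
      using nd[of n] int interior_of_maximal[of ?U "X closure_of A n" X]
      unfolding nowhere_dense_in_def by auto
    then obtain y where y: "y \<in> ?U - X closure_of A n" by blast
    have "openin X (?U - X closure_of A n)"
      by (simp add: openin_diff)
    then obtain \<sigma> where \<sigma>: "\<sigma> > 0" "B y \<sigma> \<subseteq> ?U - X closure_of A n"
      using B_subset y by blast
    moreover have "A n \<subseteq> X closure_of A n"
      using nd[of n] closure_of_subset unfolding nowhere_dense_in_def by blast
    moreover have "?U \<subseteq> B x \<rho> \<inter> T xs"
      by (rule interior_of_subset)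
    moreover have "y \<in> topspace X"
      using y interior_of_subset_topspace[of X "B x \<rho> \<inter> T xs"] by blast
    ultimately show ?thesis
      using xs by blast
  qed
  \<comment> \<open>A state is a centre with a squared radius. The prefix stays existential here and
    is chosen after the recursion.\<close>
  define Q where "Q n s s' \<longleftrightarrow> (\<exists>xs\<in>G n. B (fst s') (snd s') \<subseteq> B (fst s) (snd s) \<inter> T xs - A n)"
    for n and s s' :: "'a \<times> real"
  have "\<exists>f. \<forall>n. (fst (f n) \<in> topspace X \<and> snd (f n) > 0) \<and> Q n (f n) (f (Suc n))"
  proof (rule dependent_nat_choice)
    show "\<exists>s. fst s \<in> topspace X \<and> snd s > (0::real)"
      using x0 by (intro exI[of _ "(x0, 1)"]) simp
    show "\<exists>t. (fst t \<in> topspace X \<and> snd t > 0) \<and> Q n s t"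
      if "fst s \<in> topspace X \<and> snd s > 0" for s n
      using step[of "fst s" "snd s" n] that unfolding Q_def by force
  qed
  then obtain f where f: "\<And>n. fst (f n) \<in> topspace X" "\<And>n. snd (f n) > 0" "\<And>n. Q n (f n) (f (Suc n))"
    by blast
  define C where "C n = B (fst (f n)) (snd (f n))" for n
  define p where "p n = fst (f n)" for n
  have pC: "p n \<in> C n" for n
    unfolding p_def C_def using f(1,2)[of n] by (simp add: B_iff less_imp_le)
  have "\<exists>xs. \<forall>n. xs n \<in> G n \<and> C (Suc n) \<subseteq> C n \<inter> T (xs n) - A n"
    using f(3) unfolding Q_def C_def by metis
  then obtain xs where xs: "\<And>n. xs n \<in> G n" and C: "\<And>n. C (Suc n) \<subseteq> C n \<inter> T (xs n) - A n"
    by blast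

  \<comment> \<open>The limit of the prefixes\<close>
  have "C (Suc n) \<subseteq> C n" for n
    using C[of n] by blast
  then have decr: "C k \<subseteq> C n" if "n \<le> k" for n k
    using lift_Suc_antimono_le[of C] that by metis
  \<comment> \<open>Coordinate \<open>i\<close> is constant on \<open>C (i + 2)\<close>: this set
    lies in \<open>T (xs (i + 1))\<close>, whose prefix has length at least
    \<open>i + 1\<close>.\<close>
  define q where "q i = e (p (Suc (Suc i))) i" for i
  have q: "e x i = q i" if "x \<in> C k" "i + 2 \<le> k" for x i k
  proof -
    have "x \<in> T (xs (Suc i))" "p (Suc (Suc i)) \<in> T (xs (Suc i))"
      using that(1) decr[of "Suc (Suc i)" k] that(2) pC[of "Suc (Suc i)"] C[of "Suc i"] by auto
    moreover have "i < length (xs (Suc i))"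
      using xs[of "Suc i"] by (simp add: G_def)
    ultimately show ?thesis
      by (simp add: T_def q_def)
  qed
  \<comment> \<open>Below \<open>m\<close>, \<open>q\<close> agrees with a point of
    \<open>C n\<close> chosen late enough. The radii need not tend to 0: only coordinatewise
    convergence enters.\<close>
  have q_ball: "(\<Sum>i<m. (q i - e (fst (f n)) i)\<^sup>2) \<le> snd (f n)" for m n
  proof -
    let ?k = "max n (m + 2)"
    have "(\<Sum>i<m. (q i - e (fst (f n)) i)\<^sup>2) = (\<Sum>i<m. (e (p ?k) i - e (fst (f n)) i)\<^sup>2)"
      using q[OF pC[of ?k]] by (intro sum.cong) auto
    moreover have "p ?k \<in> C n"
      using pC[of ?k] decr[OF max.cobounded1[of n "m + 2"]] by blast
    then have "(\<Sum>i<m. (e (p ?k) i - e (fst (f n)) i)\<^sup>2) \<le> snd (f n)"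
      by (simp add: C_def B_iff)
    ultimately show ?thesis by simp
  qed
  have "q \<in> ell2"
    using mem_ell2I[OF e2[OF f(1)[of 0]] q_ball] .
  moreover have "q i \<in> \<rat>" for i
    unfolding q_def using eQ f(1) by (simp add: p_def)
  ultimately have "q \<in> topspace erdos_space"
    by (simp add: topspace_erdos_space)
  moreover have "\<exists>m. r n < (\<Sum>i<m. (q i - c n i)\<^sup>2)" for n
  proof -
    \<comment> \<open>This index is at least \<open>Suc n\<close>, so \<open>p ?k\<close> has prefix
      \<open>xs n\<close>, and late enough that \<open>q\<close> agrees with it on that prefix.
      Hence \<open>q\<close> inherits the witness from \<open>G n\<close>.\<close>
    let ?k = "Suc n + length (xs n) + 2"
    have "C ?k \<subseteq> C (Suc n)"
      by (rule decr) simp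
    then have "p ?k \<in> T (xs n)"
      using pC[of ?k] C[of n] by blast
    then have "xs n ! i = q i" if "i < length (xs n)" for i
      using q[OF pC[of ?k], of i] that by (auto simp: T_def)
    then have "r n < (\<Sum>i<length (xs n). (q i - c n i)\<^sup>2)"
      using xs[of n] by (simp add: G_def)
    then show ?thesis by blast
  qed
  ultimately have "q \<in> e ` topspace X"
    using in_image by blast
  then obtain z where z: "z \<in> topspace X" "q = e z" by blast
  have "z \<in> C n" for n
    using z q_ball by (simp add: C_def B_iff)
  then have "z \<notin> A n" for n
    using C[of n] by blast
  then show False
    using z(1) cover by blast
qed

end
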